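(* Let $r\ge 1$ be an integer and let $\chi:\mathbb{R}\to\mathbb{R}$ be a kernel satisfying $m_0(\chi,u)=1$ and $m_j(\chi,u)=0$ for $j=1,\dots,r-1$, for every $u\in\mathbb{R}$. Then for every algebraic polynomial $p_{r-1}$ (with real coefficients) of degree at most $r-1$ and every $w>0$, $$(S_w p_{r-1})(x)=\sum_{j=0}^{r-1}\frac{w^{-j}}{(j+1)!}\,p_{r-1}^{(j)}(x),\qquad x\in\mathbb{R},$$ where $$(S_w f)(x):=\sum_{k\in\mathbb{Z}}\chi(wx-k)\left[w\int_{k/w}^{(k+1)/w}f(u)\,du\right].$$ That is, $S_w$ maps algebraic polynomials of degree at most $r-1$ into algebraic polynomials of the same degree.
   Context: For $g:\mathbb{R}\to\mathbb{R}$, the discrete moment of order $\beta\in\{0,1,2,\dots\}$ at $u\in\mathbb{R}$ is $m_\beta(g,u):=\sum_{k\in\mathbb{Z}}g(u-k)(u-k)^\beta$, and the discrete absolute moment of order $\beta\ge 0$ is $M_\beta(g):=\sup_{u\in\mathbb{R}}\sum_{k\in\mathbb{Z}}|g(u-k)|\,|u-k|^\beta$. A condition prescribing the value of a discrete moment includes that the series defining it converges (absolutely). A kernel is a function $\chi:\mathbb{R}\to\mathbb{R}$ such that: (1) $\chi\in L^1(\mathbb{R})$ and $\chi$ is bounded in a neighbourhood of the origin; (2) $\sum_{k\in\mathbb{Z}}\chi(u-k)=1$ for every $u\in\mathbb{R}$; (3) there exists $\beta>0$ for which $M_\beta(\chi)<+\infty$. *)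

theory Defs
  imports "HOL-Analysis.Analysis" "HOL-Computational_Algebra.Polynomial"
begin

definition discrete_moment :: "nat \<Rightarrow> (real \<Rightarrow> real) \<Rightarrow> real \<Rightarrow> real" where
  "discrete_moment \<beta> g u = (\<Sum>\<^sub>\<infinity>k::int. g (u - of_int k) * (u - of_int k) ^ \<beta>)"

text \<open>The sum of a non-summable family is 0 by convention, so prescribing the value of a
  moment must require the absolute convergence of its series separately.\<close>

definition has_discrete_moment :: "nat \<Rightarrow> (real \<Rightarrow> real) \<Rightarrow> real \<Rightarrow> real \<Rightarrow> bool" where
  "has_discrete_moment \<beta> g u v \<longleftrightarrow>
     (\<lambda>k::int. \<bar>g (u - of_int k) * (u - of_int k) ^ \<beta>\<bar>) summable_on UNIV \<and>
     discrete_moment \<beta> g u = v"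

text \<open>The order is real, and the value may be infinite. The case distinction implements
  \<open>0\<^sup>0 = 1\<close>, whereas \<open>0 powr 0 = 0\<close>.\<close>

definition discrete_abs_moment :: "real \<Rightarrow> (real \<Rightarrow> real) \<Rightarrow> ennreal" where
  "discrete_abs_moment \<beta> g =
     (SUP u. \<Sum>\<^sub>\<infinity>k::int. ennreal (\<bar>g (u - of_int k)\<bar> *
        (if \<beta> = 0 then 1 else \<bar>u - of_int k\<bar> powr \<beta>)))"

definition sampling_kernel :: "(real \<Rightarrow> real) \<Rightarrow> bool" where
  "sampling_kernel \<kappa> \<longleftrightarrow>
     integrable lebesgue \<kappa> \<and>
     (\<exists>U. open U \<and> 0 \<in> U \<and> bounded (\<kappa> ` U)) \<and>
     (\<forall>u. ((\<lambda>k::int. \<kappa> (u - of_int k)) has_sum 1) UNIV) \<and>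
     (\<exists>\<beta>>0. discrete_abs_moment \<beta> \<kappa> < \<infinity>)"

definition kantorovich_term ::
    "(real \<Rightarrow> real) \<Rightarrow> real \<Rightarrow> (real \<Rightarrow> real) \<Rightarrow> real \<Rightarrow> int \<Rightarrow> real" where
  "kantorovich_term \<kappa> w f x k =
     \<kappa> (w * x - of_int k) *
       (w * (LINT u:{of_int k / w..(of_int k + 1) / w}|lebesgue. f u))"

definition kantorovich_op ::
    "(real \<Rightarrow> real) \<Rightarrow> real \<Rightarrow> (real \<Rightarrow> real) \<Rightarrow> real \<Rightarrow> real" where
  "kantorovich_op \<kappa> w f x = (\<Sum>\<^sub>\<infinity>k. kantorovich_term \<kappa> w f x k)"

end

theory Submission
  imports Defs
begin

text \<open>By Taylor's formula, the mean of \<open>p\<close> over the interval of length \<open>1/w\<close> that starts at \<open>a\<close>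
  is \<open>q(a)\<close>, where \<open>q = \<Sum>\<^sub>j w\<^sup>-\<^sup>j/(j+1)! p\<^sup>(\<^sup>j\<^sup>)\<close> has the degree of \<open>p\<close>. So \<open>(S\<^sub>w p)(x)\<close> is the sum of
  \<open>\<chi>(wx - k) q(k/w)\<close>. Since \<open>k/w = x - (wx - k)/w\<close>, the value \<open>q(k/w)\<close> is a polynomial in
  \<open>wx - k\<close> with constant term \<open>q(x)\<close>, and the moment conditions leave only that term.\<close>

lemma higher_pderiv_eq_0:
  fixes p :: "real poly"
  assumes "degree p < n"
  shows "(pderiv ^^ n) p = 0"
  using assms by (intro poly_eqI) (simp add: coeff_higher_pderiv coeff_eq_0)

text \<open>Maclaurin's formula in \<open>s\<close> for \<open>p(a + s)\<close> leaves a remainder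
  containing the derivative of order \<open>n\<close>, which vanishes because \<open>n\<close>
  exceeds the degree.\<close>

lemma poly_taylor:
  fixes p :: "real poly"
  assumes "degree p < n"
  shows "poly p (a + s) = (\<Sum>j<n. poly ((pderiv ^^ j) p) a / fact j * s ^ j)"
proof -
  have "((\<lambda>s. poly ((pderiv ^^ m) p) (a + s)) has_real_derivative
      poly ((pderiv ^^ Suc m) p) (a + s)) (at s)" for m s
    by (auto intro!: derivative_eq_intros DERIV_chain'[where g = "poly ((pderiv ^^ m) p)"])
  then obtain t where "poly p (a + s) = (\<Sum>j<n. poly ((pderiv ^^ j) p) (a + 0) / fact j * s ^ j)
      + poly ((pderiv ^^ n) p) (a + t) / fact n * s ^ n"
    using Maclaurin_all_le[of "\<lambda>m s. poly ((pderiv ^^ m) p) (a + s)" "\<lambda>s. poly p (a + s)" s n]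
    by auto
  then show ?thesis
    by (simp add: higher_pderiv_eq_0[OF assms])
qed

lemma lebesgue_integral_poly:
  fixes p :: "real poly"
  assumes "degree p < n" "0 \<le> h"
  shows "(LINT u:{a..a + h}|lebesgue. poly p u) =
    (\<Sum>j<n. h ^ Suc j / fact (Suc j) * poly ((pderiv ^^ j) p) a)"
proof -
  \<comment> \<open>\<open>G\<close> is the termwise antiderivative of the Taylor expansion about
    \<open>a\<close>. Every exponent is positive, so \<open>G a = 0\<close> and the integral is
    \<open>G (a + h)\<close>.\<close>
  define G where "G u = (\<Sum>j<n. (u - a) ^ Suc j / fact (Suc j) * poly ((pderiv ^^ j) p) a)" for u
  have "(G has_real_derivative poly p u) (at u within {a..a + h})" for u
  proof -
    have "((\<lambda>u. (u - a) ^ Suc j / fact (Suc j) * c) has_real_derivative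
        c / fact j * (u - a) ^ j) (at u)" for j c
      by (auto intro!: derivative_eq_intros simp del: power_Suc of_nat_Suc)
    then have "(G has_real_derivative
        (\<Sum>j<n. poly ((pderiv ^^ j) p) a / fact j * (u - a) ^ j)) (at u)"
      unfolding G_def by (intro DERIV_sum)
    then show ?thesis
      using poly_taylor[OF assms(1), of a "u - a"] by (simp add: has_field_derivative_at_within)
  qed
  then have "(poly p has_integral (G (a + h) - G a)) {a..a + h}"
    using assms(2) by (intro fundamental_theorem_of_calculus)
      (auto simp: has_real_derivative_iff_has_vector_derivative[symmetric])
  \<comment> \<open>Absolute integrability identifies the Lebesgue integral with the gauge integral
    just computed.\<close>
  moreover have "set_integrable lebesgue {a..a + h} (poly p)"
    by (intro absolutely_integrable_continuous_real continuous_intros)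
  ultimately show ?thesis
    by (simp add: set_lebesgue_integral_eq_integral(2) integral_unique G_def)
qed

definition kantorovich_poly :: "nat \<Rightarrow> real \<Rightarrow> real poly \<Rightarrow> real poly" where
  "kantorovich_poly n w p = (\<Sum>j<n. smult (w powi (- int j) / fact (j + 1)) ((pderiv ^^ j) p))"

lemma cell_mean_poly:
  fixes p :: "real poly"
  assumes "degree p < n" "w > 0"
  shows "w * (LINT u:{of_int k / w..(of_int k + 1) / w}|lebesgue. poly p u) =
    poly (kantorovich_poly n w p) (of_int k / w)"
proof -
  \<comment> \<open>The factor \<open>w\<close> of the mean absorbs one of the \<open>j + 1\<close>
    powers of the cell length \<open>1 / w\<close>.\<close>
  have "w * (1 / w) ^ Suc j = w powi (- int j)" for j
    using assms(2) by (simp add: power_int_minus power_one_over field_simps)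
  then show ?thesis
    using lebesgue_integral_poly[OF assms(1), of "1 / w" "of_int k / w"] assms(2)
    by (simp add: kantorovich_poly_def poly_sum add_divide_distrib sum_distrib_left
        mult.assoc[symmetric] del: fact_Suc power_Suc)
qed

text \<open>The summand \<open>j = 0\<close> is \<open>p\<close> itself, and it is present because
  \<open>n > 0\<close>. The other summands are multiples of proper derivatives, so they cannot
  affect the leading coefficient.\<close>

lemma degree_kantorovich_poly:
  assumes "n > 0"
  shows "degree (kantorovich_poly n w p) = degree p"
proof (rule antisym)
  show le: "degree (kantorovich_poly n w p) \<le> degree p"
    unfolding kantorovich_poly_def
    by (intro degree_sum_le order.trans[OF degree_smult_le]) (simp_all add: degree_higher_pderiv)
  have "coeff (kantorovich_poly n w p) (degree p) =
      (\<Sum>j<n. if j = 0 then lead_coeff p else 0)"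
    unfolding kantorovich_poly_def coeff_sum
    by (intro sum.cong) (auto simp: coeff_higher_pderiv coeff_eq_0)
  also have "\<dots> = lead_coeff p"
    using assms by simp
  finally show "degree p \<le> degree (kantorovich_poly n w p)"
    by (cases "p = 0") (auto intro: le_degree)
qed

text \<open>Absolute summability ensures that the prescribed value is a true sum and not the default
  0.\<close>

lemma has_discrete_moment_has_sum:
  assumes "has_discrete_moment j g u v"
  shows "((\<lambda>k::int. g (u - of_int k) * (u - of_int k) ^ j) has_sum v) UNIV"
  using assms abs_summable_summable[of "\<lambda>k::int. g (u - of_int k) * (u - of_int k) ^ j" UNIV]
  by (auto simp: has_discrete_moment_def discrete_moment_def intro!: has_sum_infsum)

lemma has_sum_finite_sum:
  fixes f :: "'i \<Rightarrow> 'a \<Rightarrow> 'b :: topological_comm_monoid_add"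
  assumes "\<And>i. i \<in> I \<Longrightarrow> (f i has_sum s i) A"
  shows "((\<lambda>x. \<Sum>i\<in>I. f i x) has_sum (\<Sum>i\<in>I. s i)) A"
  using assms by (induction I rule: infinite_finite_induct) (auto intro: has_sum_add)

text \<open>Expanding \<open>s\<close> in monomials gives a finite linear combination of moment
  series, in which only the moment of order 0 survives.\<close>

lemma has_sum_kernel_poly:
  fixes s :: "real poly"
  assumes "has_discrete_moment 0 \<kappa> u 1"
    and "\<And>j. j \<in> {1..degree s} \<Longrightarrow> has_discrete_moment j \<kappa> u 0"
  shows "((\<lambda>k::int. \<kappa> (u - of_int k) * poly s (u - of_int k)) has_sum coeff s 0) UNIV"
proof -
  have "((\<lambda>k::int. \<Sum>j\<le>degree s. coeff s j * (\<kappa> (u - of_int k) * (u - of_int k) ^ j)) has_sum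
      (\<Sum>j\<le>degree s. coeff s j * (if j = 0 then 1 else 0))) UNIV"
    using assms by (intro has_sum_finite_sum has_sum_cmult_right has_discrete_moment_has_sum) auto
  then show ?thesis
    by (simp add: poly_altdef sum_distrib_left mult_ac if_distrib cong: if_cong)
qed

lemma has_sum_sampling_poly:
  fixes q :: "real poly"
  assumes "w \<noteq> 0"
    and "has_discrete_moment 0 \<kappa> (w * x) 1"
    and "\<And>j. j \<in> {1..degree q} \<Longrightarrow> has_discrete_moment j \<kappa> (w * x) 0"
  shows "((\<lambda>k::int. \<kappa> (w * x - of_int k) * poly q (of_int k / w)) has_sum poly q x) UNIV"
proof -
  \<comment> \<open>Thus \<open>s(t) = q(x - t/w)\<close>, which is \<open>q(k/w)\<close> at
    \<open>t = wx - k\<close> and \<open>q(x)\<close> at \<open>t = 0\<close>. The inner polynomial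
    has degree 1, so the degree is unchanged and no further moments are required.\<close>
  define s where "s = pcompose q [:x, - 1 / w:]"
  have "degree s = degree q"
    using assms(1) by (simp add: s_def degree_pcompose)
  moreover have "coeff s 0 = poly q x"
    by (simp add: s_def coeff_pcompose_0)
  moreover have "poly s (w * x - of_int k) = poly q (of_int k / w)" for k
    using assms(1) by (simp add: s_def poly_pcompose diff_divide_distrib)
  ultimately show ?thesis
    using has_sum_kernel_poly[of \<kappa> "w * x" s] assms(2,3) by simp
qed

theorem theorem3p5:
  fixes r :: nat and \<kappa> :: "real \<Rightarrow> real" and p :: "real poly" and w :: real
  assumes "r \<ge> 1"
    and "sampling_kernel \<kappa>"
    and "\<And>u. has_discrete_moment 0 \<kappa> u 1"
    and "\<And>j u. j \<in> {1..r - 1} \<Longrightarrow> has_discrete_moment j \<kappa> u 0"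
    and "degree p \<le> r - 1"
    and "w > 0"
  shows "(\<forall>x. kantorovich_term \<kappa> w (poly p) x summable_on UNIV \<and>
            kantorovich_op \<kappa> w (poly p) x =
              (\<Sum>j = 0..r - 1. w powi (- int j) / fact (j + 1) * poly ((pderiv ^^ j) p) x)) \<and>
         (\<exists>q :: real poly. degree q = degree p \<and> kantorovich_op \<kappa> w (poly p) = poly q)"
proof -
  define q where "q = kantorovich_poly r w p"
  have deg: "degree q = degree p"
    using assms(1) by (simp add: q_def degree_kantorovich_poly)
  have "degree p < r"
    using assms(1,5) by simp
  then have "kantorovich_term \<kappa> w (poly p) x =
      (\<lambda>k. \<kappa> (w * x - of_int k) * poly q (of_int k / w))" for x
    using assms(6) by (simp add: fun_eq_iff kantorovich_term_def q_def cell_mean_poly)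
  moreover have "((\<lambda>k::int. \<kappa> (w * x - of_int k) * poly q (of_int k / w)) has_sum poly q x) UNIV"
    for x
    \<comment> \<open>The moment conditions reach order \<open>r - 1\<close>, which bounds the
      degree of \<open>q\<close> since it equals that of \<open>p\<close>.\<close>
    using assms(3-6) deg by (intro has_sum_sampling_poly) auto
  ultimately have sums: "(kantorovich_term \<kappa> w (poly p) x has_sum poly q x) UNIV" for x
    by simp
  then have op: "kantorovich_op \<kappa> w (poly p) = poly q"
    by (simp add: fun_eq_iff kantorovich_op_def infsumI)
  \<comment> \<open>With truncated subtraction this requires \<open>r\<close> to be
    positive.\<close>
  have "{..<r} = {0..r - 1}"
    using assms(1) by auto
  then have "poly q x =
      (\<Sum>j = 0..r - 1. w powi (- int j) / fact (j + 1) * poly ((pderiv ^^ j) p) x)" for x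
    by (simp add: q_def kantorovich_poly_def poly_sum)
  with sums op deg show ?thesis
    by (auto intro: has_sum_imp_summable)
qed

end
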